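(* There are absolute constants $C>0$ and $\alpha>0$ such that the following holds. Let $n, N, c$ be positive integers with $N \ge 10n$, let $f:\mathbb{F}_2^n \to \{0,1\}$, and let $F:(\mathbb{F}_2^n)^N \to \{0,1\}$ be defined by $F(x_1,\ldots,x_N) = f(x_1+\cdots+x_N)$. Suppose that $F$ has a one-way broadcasting protocol with $c$ bits of communication per message and success probability $q$. Then there exists a linear sketch of cost $k$ which computes $f$ with success probability at least $q - 2^{-\alpha N}$, where $k \le C c$ (i.e. $k = O(c)$).
   Context: One-way broadcasting protocol: there are $N$ players, player $i$ holding input $x_i\in\mathbb{F}_2^n$, and the players share a random string $\mathbf{r}\in\{0,1\}^{r}$. The players speak in order $1,\ldots,N$; player $i$ sends the message $\mathbf{m}_i = M_i(x_i,\mathbf{m}_1,\ldots,\mathbf{m}_{i-1},\mathbf{r})$, where for $1\le i\le N-1$ the message $\mathbf{m}_i\in\{0,1\}^c$ (this is "$c$ bits of communication per message"), and the last message $\mathbf{m}_N\in\{0,1\}$ is the output of the protocol, written $G(x_1,\ldots,x_N,\mathbf{r})$. The protocol computes $F$ with success probability $q$ if for all inputs $x_1,\ldots,x_N\in\mathbb{F}_2^n$, $\Pr_{\mathbf{r}}[G(x_1,\ldots,x_N,\mathbf{r}) = F(x_1,\ldots,x_N)]\ge q$. A function $g:\mathbb{F}_2^n\to\{0,1\}$ is a $k$-linear-junta if $g(x)=h(\ell_1(x),\ldots,\ell_k(x))$ for some linear functions $\ell_1,\ldots,\ell_k:\mathbb{F}_2^n\to\mathbb{F}_2$ and an arbitrary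 $h:\mathbb{F}_2^k\to\{0,1\}$. A linear sketch of cost $k$ is a probability distribution $\mathbf{g}$ over $k$-linear-juntas; it computes $f$ with success probability $q'$ if for every $x\in\mathbb{F}_2^n$, $\Pr[\mathbf{g}(x)=f(x)]\ge q'$. *)

theory Defs
  imports
    "HOL-Probability.Probability"
    "HOL-Library.Z2"
    "Jordan_Normal_Form.Matrix"
begin

text \<open>
  The space \<open>\<bbbF>\<^sub>2\<^sup>n\<close> is \<^term>\<open>carrier_vec n :: bit vec set\<close>, where \<^typ>\<open>bit\<close> is the field with
  two elements; truth values and message bits are of type \<^typ>\<open>bool\<close>. A function on
  \<open>\<bbbF>\<^sub>2\<^sup>n\<close> is a total HOL function on \<^typ>\<open>bit vec\<close> that is constrained only on the carrier.
\<close>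

definition linear_functional :: "nat \<Rightarrow> (bit vec \<Rightarrow> bit) \<Rightarrow> bool" where
  "linear_functional n l \<longleftrightarrow>
     (\<forall>u \<in> carrier_vec n. \<forall>v \<in> carrier_vec n. l (u + v) = l u + l v) \<and>
     (\<forall>a. \<forall>v \<in> carrier_vec n. l (a \<cdot>\<^sub>v v) = a * l v)"

definition linear_junta :: "nat \<Rightarrow> nat \<Rightarrow> (bit vec \<Rightarrow> bool) \<Rightarrow> bool" where
  "linear_junta n k g \<longleftrightarrow>
     (\<exists>(l :: nat \<Rightarrow> bit vec \<Rightarrow> bit) (h :: bit vec \<Rightarrow> bool).
        (\<forall>i<k. linear_functional n (l i)) \<and>
        (\<forall>x \<in> carrier_vec n. g x = h (vec k (\<lambda>i. l i x))))"

text \<open>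
  Only finitely many functions on \<open>\<bbbF>\<^sub>2\<^sup>n\<close> exist, so discrete distributions lose no generality.
\<close>

definition linear_sketch :: "nat \<Rightarrow> nat \<Rightarrow> (bit vec \<Rightarrow> bool) pmf \<Rightarrow> bool" where
  "linear_sketch n k G \<longleftrightarrow> (\<forall>g \<in> set_pmf G. linear_junta n k g)"

definition sketch_computes ::
    "nat \<Rightarrow> (bit vec \<Rightarrow> bool) pmf \<Rightarrow> (bit vec \<Rightarrow> bool) \<Rightarrow> real \<Rightarrow> bool" where
  "sketch_computes n G f q \<longleftrightarrow>
     (\<forall>x \<in> carrier_vec n. measure_pmf.prob G {g. g x = f x} \<ge> q)"

definition bitstrings :: "nat \<Rightarrow> bool list set" where
  "bitstrings m = {s. length s = m}"

text \<open>
  Players are numbered \<open>0, \<dots>, N - 1\<close>. Player \<open>i < N - 1\<close> sends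
  \<open>message P i x\<^sub>i [m\<^sub>0, \<dots>, m\<^bsub>i-1\<^esub>] r\<close>; the last player sends the single bit
  \<open>output_bit P x\<^bsub>N-1\<^esub> [m\<^sub>0, \<dots>, m\<^bsub>N-2\<^esub>] r\<close>, the output of the protocol.
\<close>

record broadcast_protocol =
  rand_len :: nat
  message :: "nat \<Rightarrow> bit vec \<Rightarrow> bool list list \<Rightarrow> bool list \<Rightarrow> bool list"
  output_bit :: "bit vec \<Rightarrow> bool list list \<Rightarrow> bool list \<Rightarrow> bool"

definition protocol_with_cost :: "nat \<Rightarrow> nat \<Rightarrow> nat \<Rightarrow> broadcast_protocol \<Rightarrow> bool" where
  "protocol_with_cost n N c P \<longleftrightarrow>
     (\<forall>i < N - 1. \<forall>x \<in> carrier_vec n. \<forall>ms. \<forall>r \<in> bitstrings (rand_len P).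
        length ms = i \<and> set ms \<subseteq> bitstrings c \<longrightarrow> message P i x ms r \<in> bitstrings c)"

primrec transcript ::
    "broadcast_protocol \<Rightarrow> (nat \<Rightarrow> bit vec) \<Rightarrow> bool list \<Rightarrow> nat \<Rightarrow> bool list list" where
  "transcript P x r 0 = []"
| "transcript P x r (Suc i) =
     transcript P x r i @ [message P i (x i) (transcript P x r i) r]"

definition protocol_output ::
    "nat \<Rightarrow> broadcast_protocol \<Rightarrow> (nat \<Rightarrow> bit vec) \<Rightarrow> bool list \<Rightarrow> bool" where
  "protocol_output N P x r = output_bit P (x (N - 1)) (transcript P x r (N - 1)) r"

definition protocol_computes ::
    "nat \<Rightarrow> nat \<Rightarrow> broadcast_protocol \<Rightarrow> ((nat \<Rightarrow> bit vec) \<Rightarrow> bool) \<Rightarrow> real \<Rightarrow> bool" where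
  "protocol_computes n N P F q \<longleftrightarrow>
     (\<forall>x. (\<forall>i<N. x i \<in> carrier_vec n) \<longrightarrow>
        measure_pmf.prob (pmf_of_set (bitstrings (rand_len P)))
          {r. protocol_output N P x r = F x} \<ge> q)"

definition has_broadcast_protocol ::
    "nat \<Rightarrow> nat \<Rightarrow> nat \<Rightarrow> ((nat \<Rightarrow> bit vec) \<Rightarrow> bool) \<Rightarrow> real \<Rightarrow> bool" where
  "has_broadcast_protocol n N c F q \<longleftrightarrow>
     (\<exists>P. protocol_with_cost n N c P \<and> protocol_computes n N P F q)"

end

theory Submission
  imports Defs "HOL-Analysis.Harmonic_Numbers"
begin

text \<open>
  Fix the shared randomness and let the first \<open>m = N - 1\<close> players hold independent uniform inputs;
  the last player receives \<open>x + S\<close>, where \<open>S\<close> is the sum of the others. Given a transcript, the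
  input of player \<open>i\<close> is uniform on a set \<open>A\<^sub>i\<close>, so the character sums of \<open>S\<close> are the products of
  the character biases of the \<open>A\<^sub>i\<close>. The level-one inequality bounds the sum of the squared biases
  of \<open>A\<^sub>i\<close> over independent characters by \<open>2 ln (2\<^sup>n / |A\<^sub>i|)\<close>. Adding this over \<open>i\<close> shows that, unless
  the transcript has probability below \<open>2\<close> to the power \<open>- 2cm\<close>, the characters whose product of
  biases exceeds \<open>2\<close> to the power \<open>- m/2\<close> span a space of dimension at most \<open>10c\<close>. All other
  characters together contribute an exponentially small amount because \<open>m \<ge> 9n\<close>, so \<open>S\<close> is almost
  invariant under the annihilator \<open>V\<close> of that space. Hence \<open>x\<close> may be replaced by a uniformly random
  element of \<open>x + V\<close>, which depends on \<open>x\<close> only through at most \<open>10c\<close> linear functionals. There are at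
  most \<open>2\<close> to the power \<open>cm\<close> transcripts, so the improbable ones are negligible in total.
\<close>

section \<open>Characters of the binary cube\<close>

definition chi :: "bit vec \<Rightarrow> bit vec \<Rightarrow> real" where
  "chi u x = (if u \<bullet> x = 0 then 1 else -1)"

lemma UNIV_bit: "(UNIV :: bit set) = {0, 1}"
  using bit_not_zero_iff by blast

lemma
  shows finite_carrier_vec_bit [simp]: "finite (carrier_vec n :: bit vec set)"
    and card_carrier_vec_bit: "card (carrier_vec n :: bit vec set) = 2 ^ n"
proof -
  let ?L = "{xs :: bit list. set xs \<subseteq> UNIV \<and> length xs = n}"
  have bij: "bij_betw vec_of_list ?L (carrier_vec n)"
    by (rule bij_betw_byWitness[where f' = list_of_vec])
       (auto simp only: list_vec vec_list dim_vec_of_list length_list_of_vec carrier_dim_vec)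
  have "finite (UNIV :: bit set)" by (simp add: UNIV_bit)
  then have "finite ?L" by (rule finite_lists_length_eq)
  then show "finite (carrier_vec n :: bit vec set)"
    using bij_betw_finite[OF bij] by simp
  have "card (UNIV :: bit set) = 2" by (simp add: UNIV_bit)
  then have "card ?L = 2 ^ n"
    using card_lists_length_eq[of "UNIV :: bit set" n] \<open>finite (UNIV :: bit set)\<close> by metis
  then show "card (carrier_vec n :: bit vec set) = 2 ^ n"
    using bij_betw_same_card[OF bij] by metis
qed

lemma add_self_bit_vec [simp]: "(x :: bit vec) \<in> carrier_vec n \<Longrightarrow> x + x = 0\<^sub>v n"
  by (intro eq_vecI) auto

lemma add_add_cancel_bit_vec:
  "(x :: bit vec) \<in> carrier_vec n \<Longrightarrow> y \<in> carrier_vec n \<Longrightarrow> x + (x + y) = y"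
  by (metis add_self_bit_vec assoc_add_vec left_zero_vec)

lemma bij_betw_add_bit_vec:
  assumes "(u :: bit vec) \<in> carrier_vec n"
  shows "bij_betw ((+) u) (carrier_vec n) (carrier_vec n)"
  by (rule bij_betw_byWitness[where f' = "(+) u"])
     (use assms in \<open>auto simp: add_add_cancel_bit_vec\<close>)

lemma chi_add:
  assumes "u \<in> carrier_vec n" "x \<in> carrier_vec n" "y \<in> carrier_vec n"
  shows "chi u (x + y) = chi u x * chi u y"
  using assms by (auto simp: chi_def scalar_prod_add_distrib[of _ n])

lemma chi_commute: "u \<in> carrier_vec n \<Longrightarrow> x \<in> carrier_vec n \<Longrightarrow> chi u x = chi x u"
  by (simp add: chi_def comm_scalar_prod)

lemma chi_eq_or: "chi u x = 1 \<or> chi u x = -1"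
  by (auto simp: chi_def)

lemma abs_chi [simp]: "\<bar>chi u x\<bar> = 1"
  by (simp add: chi_def)

lemma chi_mult_self [simp]: "chi u x * chi u x = 1"
  by (simp add: chi_def)

lemma chi_zero [simp]: "u \<in> carrier_vec n \<Longrightarrow> chi u (0\<^sub>v n) = 1"
  by (simp add: chi_def)

text \<open>Translating the sum by \<open>u\<close> multiplies it by \<open>\<psi> u\<close>.\<close>

lemma sum_multiplicative_eq_0:
  fixes \<psi> :: "bit vec \<Rightarrow> real"
  assumes mult: "\<And>x y. x \<in> carrier_vec n \<Longrightarrow> y \<in> carrier_vec n \<Longrightarrow> \<psi> (x + y) = \<psi> x * \<psi> y"
    and u: "u \<in> carrier_vec n" "\<psi> u \<noteq> 1"
  shows "(\<Sum>x\<in>carrier_vec n. \<psi> x) = 0"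
proof -
  have "(\<Sum>x\<in>carrier_vec n. \<psi> x) = (\<Sum>x\<in>carrier_vec n. \<psi> (u + x))"
    by (rule sum.reindex_bij_betw[symmetric, OF bij_betw_add_bit_vec[OF u(1)]])
  also have "\<dots> = \<psi> u * (\<Sum>x\<in>carrier_vec n. \<psi> x)"
    by (simp add: mult u sum_distrib_left)
  finally show ?thesis using u(2) by simp
qed

text \<open>Orthogonality, summed over the characters: by the symmetry of \<open>\<bullet>\<close>
  the summand is multiplicative in \<open>u\<close>, and the unit vector at a nonzero coordinate of
  \<open>x\<close> gives it the value -1.\<close>

lemma sum_chi:
  assumes x: "x \<in> carrier_vec n"
  shows "(\<Sum>u\<in>carrier_vec n. chi u x) = (if x = 0\<^sub>v n then 2 ^ n else 0)"
proof (cases "x = 0\<^sub>v n")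
  case True
  then show ?thesis by (simp add: card_carrier_vec_bit)
next
  case False
  then obtain i where i: "i < n" "x $ i \<noteq> 0"
    using x by (metis eq_vecI carrier_vecD index_zero_vec)
  have "chi (unit_vec n i) x \<noteq> 1"
    using i x by (simp add: chi_def)
  moreover have "chi (u + w) x = chi u x * chi w x" if "u \<in> carrier_vec n" "w \<in> carrier_vec n" for u w
    using that x chi_add[OF x that] by (simp add: chi_commute[OF _ x])
  ultimately show ?thesis
    using False by (simp add: sum_multiplicative_eq_0[where u = "unit_vec n i"])
qed

text \<open>Swapping the sums leaves the sum of \<open>chi u (x + s)\<close> over all
  \<open>u\<close>, which is \<open>2 ^ n\<close> times the point mass at \<open>x = s\<close>,
  because \<open>x + s\<close> vanishes only for \<open>x = s\<close> in characteristic two.\<close>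

lemma fourier_expansion:
  fixes B :: "bit vec \<Rightarrow> real"
  assumes s: "s \<in> carrier_vec n"
  shows "B s = (\<Sum>u\<in>carrier_vec n. ((\<Sum>x\<in>carrier_vec n. B x * chi u x) / 2 ^ n) * chi u s)"
proof -
  have "(\<Sum>u\<in>carrier_vec n. ((\<Sum>x\<in>carrier_vec n. B x * chi u x) / 2 ^ n) * chi u s)
      = (\<Sum>u\<in>carrier_vec n. \<Sum>x\<in>carrier_vec n. B x / 2 ^ n * chi u (x + s))"
    using s by (simp add: sum_distrib_right sum_divide_distrib chi_add[of _ n] mult.assoc
        cong: sum.cong)
  also have "\<dots> = (\<Sum>x\<in>carrier_vec n. B x / 2 ^ n * (\<Sum>u\<in>carrier_vec n. chi u (x + s)))"
    by (subst sum.swap) (simp add: sum_distrib_left)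
  also have "\<dots> = (\<Sum>x\<in>carrier_vec n. if x = s then B x else 0)"
  proof (intro sum.cong refl)
    fix x :: "bit vec" assume x: "x \<in> carrier_vec n"
    have "x + s = 0\<^sub>v n \<longleftrightarrow> x = s"
      using x s by (metis add_self_bit_vec add_add_cancel_bit_vec right_zero_vec)
    then show "B x / 2 ^ n * (\<Sum>u\<in>carrier_vec n. chi u (x + s)) = (if x = s then B x else 0)"
      using x s by (simp add: sum_chi)
  qed
  also have "\<dots> = B s" using s by simp
  finally show ?thesis by simp
qed

text \<open>Linear independence over \<open>\<bbbF>\<^sub>2\<close>: no product over a nonempty subfamily is the trivial character.\<close>

definition independent_chars :: "nat \<Rightarrow> bit vec set \<Rightarrow> bool" where
  "independent_chars n J \<longleftrightarrow>
     (\<forall>T\<subseteq>J. T \<noteq> {} \<longrightarrow> (\<Sum>x\<in>carrier_vec n. \<Prod>u\<in>T. chi u x) = 0)"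

text \<open>Expanding over the subsets \<open>T\<close> of \<open>J\<close> turns each term into a
  multiple of the product of the characters in \<open>T\<close>; independence makes its sum vanish
  unless \<open>T\<close> is empty.\<close>

lemma riesz_product_sum:
  assumes J: "finite J" "independent_chars n J"
  shows "(\<Sum>x\<in>carrier_vec n. \<Prod>u\<in>J. a u + b u * chi u x) = 2 ^ n * (\<Prod>u\<in>J. a u)"
proof -
  have "(\<Sum>x\<in>carrier_vec n. \<Prod>u\<in>J. a u + b u * chi u x)
      = (\<Sum>x\<in>carrier_vec n. \<Prod>u\<in>J. b u * chi u x + a u)"
    by (simp add: add.commute)
  also have "\<dots> = (\<Sum>x\<in>carrier_vec n. \<Sum>T\<in>Pow J. (\<Prod>u\<in>T. b u * chi u x) * (\<Prod>u\<in>J-T. a u))"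
    by (simp add: prod_add[OF J(1)])
  also have "\<dots> = (\<Sum>T\<in>Pow J. \<Sum>x\<in>carrier_vec n. (\<Prod>u\<in>T. b u * chi u x) * (\<Prod>u\<in>J-T. a u))"
    by (rule sum.swap)
  also have "\<dots> = (\<Sum>T\<in>Pow J. if T = {} then 2 ^ n * (\<Prod>u\<in>J. a u) else 0)"
  proof (rule sum.cong[OF refl])
    fix T assume "T \<in> Pow J"
    moreover have "(\<Sum>x\<in>carrier_vec n. (\<Prod>u\<in>T. b u * chi u x) * (\<Prod>u\<in>J-T. a u))
        = (\<Prod>u\<in>T. b u) * (\<Prod>u\<in>J-T. a u) * (\<Sum>x\<in>carrier_vec n. \<Prod>u\<in>T. chi u x)"
      by (simp add: prod.distrib sum_distrib_left mult_ac)
    ultimately show "(\<Sum>x\<in>carrier_vec n. (\<Prod>u\<in>T. b u * chi u x) * (\<Prod>u\<in>J-T. a u))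
        = (if T = {} then 2 ^ n * (\<Prod>u\<in>J. a u) else 0)"
      using J(2) by (auto simp: independent_chars_def card_carrier_vec_bit)
  qed
  also have "\<dots> = 2 ^ n * (\<Prod>u\<in>J. a u)"
    using J(1) by simp
  finally show ?thesis .
qed

section \<open>Hyperbolic estimates and the level-one inequality\<close>

lemma sinh_le_mult_cosh:
  fixes t :: real
  assumes "0 \<le> t"
  shows "sinh t \<le> t * cosh t"
proof -
  have "(\<lambda>s. s * cosh s - sinh s) 0 \<le> (\<lambda>s. s * cosh s - sinh s) t"
    by (rule DERIV_nonneg_imp_nondecreasing[OF assms])
       (auto intro!: exI derivative_eq_intros simp: sinh_real_nonneg_iff)
  then show ?thesis by simp
qed

text \<open>The derivative of \<open>cosh s * exp (- (s\<^sup>2 / 2))\<close> has the sign of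
  \<open>sinh s - s * cosh s\<close>, so this function does not rise above its value 1 at zero for
  nonnegative arguments; evenness covers negative \<open>t\<close>.\<close>

lemma cosh_le_exp_half_square: "cosh (t :: real) \<le> exp (t\<^sup>2 / 2)"
proof -
  have *: "cosh t \<le> exp (t\<^sup>2 / 2)" if "0 \<le> t" for t :: real
  proof -
    have "(\<lambda>s. cosh s * exp (- (s\<^sup>2 / 2))) t \<le> (\<lambda>s. cosh s * exp (- (s\<^sup>2 / 2))) 0"
    proof (rule DERIV_nonpos_imp_nonincreasing[OF that])
      fix s :: real assume s: "0 \<le> s" "s \<le> t"
      have "((\<lambda>s. cosh s * exp (- (s\<^sup>2 / 2))) has_real_derivative
          (sinh s - s * cosh s) * exp (- (s\<^sup>2 / 2))) (at s)"
        by (auto intro!: derivative_eq_intros simp: algebra_simps)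
      moreover have "(sinh s - s * cosh s) * exp (- (s\<^sup>2 / 2)) \<le> 0"
        using sinh_le_mult_cosh[OF s(1)] by (simp add: mult_le_0_iff)
      ultimately show "\<exists>y. ((\<lambda>s. cosh s * exp (- (s\<^sup>2 / 2))) has_real_derivative y) (at s) \<and> y \<le> 0"
        by blast
    qed
    then show ?thesis by (simp add: exp_minus field_simps)
  qed
  show ?thesis
    using *[of "\<bar>t\<bar>"] by (cases "0 \<le> t") auto
qed

text \<open>The Fourier coefficient at \<open>u\<close> of the uniform distribution on
  \<open>A\<close>. Division by zero makes it 0 for empty \<open>A\<close>.\<close>

definition bias :: "bit vec set \<Rightarrow> bit vec \<Rightarrow> real" where
  "bias A u = (\<Sum>x\<in>A. chi u x) / card A"

lemma abs_bias_le_1: "\<bar>bias A u\<bar> \<le> 1"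
proof -
  have "\<bar>\<Sum>x\<in>A. chi u x\<bar> \<le> (\<Sum>x\<in>A. \<bar>chi u x\<bar>)" by (rule sum_abs)
  then show ?thesis by (cases "card A = 0") (auto simp: bias_def abs_divide field_simps)
qed

text \<open>With the biases as weights, \<open>Z\<close> has mean \<open>W\<close> on
  \<open>A\<close>, so by convexity \<open>exp (Z x - W)\<close> sums to at least
  \<open>card A\<close> over \<open>A\<close>. Over the whole cube \<open>exp (Z x)\<close> is a
  Riesz product with total at most \<open>2 ^ n * exp (W / 2)\<close>. Comparing the two gives
  \<open>card A \<le> 2 ^ n * exp (- (W / 2))\<close>.\<close>

lemma level_one_inequality:
  assumes J: "finite J" "independent_chars n J"
    and A: "A \<subseteq> carrier_vec n" "A \<noteq> {}"
  shows "(\<Sum>u\<in>J. (bias A u)\<^sup>2) \<le> 2 * ln (2 ^ n / card A)"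
proof -
  define W where "W = (\<Sum>u\<in>J. (bias A u)\<^sup>2)"
  have fin: "finite A" using A(1) finite_subset by fastforce
  then have pos: "real (card A) > 0" using A(2) by (simp add: card_gt_0_iff)
  define Z where "Z x = (\<Sum>u\<in>J. bias A u * chi u x)" for x
  have mean: "(\<Sum>x\<in>A. Z x) = card A * W"
  proof -
    have "(\<Sum>u\<in>J. \<Sum>x\<in>A. bias A u * chi u x) = (\<Sum>u\<in>J. card A * (bias A u)\<^sup>2)"
    proof (rule sum.cong[OF refl])
      fix u
      have "(\<Sum>x\<in>A. chi u x) = card A * bias A u"
        using pos by (simp add: bias_def)
      then show "(\<Sum>x\<in>A. bias A u * chi u x) = card A * (bias A u)\<^sup>2"
        by (simp add: sum_distrib_left[symmetric] power2_eq_square)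
    qed
    then show ?thesis
      unfolding Z_def W_def by (subst sum.swap) (simp add: sum_distrib_left)
  qed
  have "card A = (\<Sum>x\<in>A. 1 + (Z x - W))"
    using mean by (simp add: sum.distrib sum_subtractf)
  also have "\<dots> \<le> (\<Sum>x\<in>A. exp (Z x - W))"
    by (intro sum_mono exp_ge_add_one_self)
  also have "\<dots> \<le> (\<Sum>x\<in>carrier_vec n. exp (Z x - W))"
    by (intro sum_mono2) (use A in auto)
  also have "\<dots> = (\<Sum>x\<in>carrier_vec n. exp (Z x)) / exp W"
    by (simp add: exp_diff sum_divide_distrib)
  also have "(\<Sum>x\<in>carrier_vec n. exp (Z x))
      = (\<Sum>x\<in>carrier_vec n. \<Prod>u\<in>J. cosh (bias A u) + sinh (bias A u) * chi u x)"
  proof (rule sum.cong[OF refl])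
    fix x
    \<comment> \<open>A character takes only the values 1 and -1, so this exponential is affine in
      it.\<close>
    have "exp (bias A u * chi u x) = cosh (bias A u) + sinh (bias A u) * chi u x" for u
      using chi_eq_or[of u x] by (elim disjE) (simp_all add: cosh_plus_sinh cosh_minus_sinh)
    then show "exp (Z x) = (\<Prod>u\<in>J. cosh (bias A u) + sinh (bias A u) * chi u x)"
      by (simp add: Z_def exp_sum[OF J(1)])
  qed
  also have "\<dots> = 2 ^ n * (\<Prod>u\<in>J. cosh (bias A u))"
    by (rule riesz_product_sum[OF J])
  also have "2 ^ n * (\<Prod>u\<in>J. cosh (bias A u)) / exp W \<le> 2 ^ n * exp (W / 2) / exp W"
  proof -
    have "(\<Prod>u\<in>J. cosh (bias A u)) \<le> (\<Prod>u\<in>J. exp ((bias A u)\<^sup>2 / 2))"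
      by (intro prod_mono conjI cosh_real_nonneg cosh_le_exp_half_square)
    also have "\<dots> = exp (W / 2)"
      by (simp add: W_def exp_sum[OF J(1), symmetric] sum_divide_distrib)
    finally show ?thesis by (intro divide_right_mono mult_left_mono) auto
  qed
  also have "\<dots> = 2 ^ n * exp (- (W / 2))"
  proof -
    have "exp (W / 2) / exp W = exp (- (W / 2))"
      by (simp add: exp_diff[symmetric])
    then show ?thesis by (metis times_divide_eq_right)
  qed
  finally have "card A \<le> 2 ^ n * exp (- (W / 2))" .
  then have "card A * exp (W / 2) \<le> 2 ^ n * exp (- (W / 2)) * exp (W / 2)"
    by (rule mult_right_mono) simp
  also have "\<dots> = 2 ^ n"
    by (simp only: mult.assoc exp_add[symmetric]) simp
  finally have "exp (W / 2) \<le> 2 ^ n / card A"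
    using pos by (simp add: pos_le_divide_eq mult.commute)
  then have "W / 2 \<le> ln (2 ^ n / card A)"
    using pos by (subst ln_ge_iff) auto
  then show ?thesis by (simp add: W_def)
qed

section \<open>Sums of independent variables on dense sets\<close>

definition annihilator :: "nat \<Rightarrow> bit vec set \<Rightarrow> bit vec set" where
  "annihilator n J = {v \<in> carrier_vec n. \<forall>u\<in>J. chi u v = 1}"

lemma zero_mem_annihilator: "J \<subseteq> carrier_vec n \<Longrightarrow> 0\<^sub>v n \<in> annihilator n J"
  by (auto simp: annihilator_def)

lemma annihilator_subset: "annihilator n J \<subseteq> carrier_vec n"
  by (auto simp: annihilator_def)

lemma finite_annihilator [simp]: "finite (annihilator n J)"
  by (rule finite_subset[OF annihilator_subset]) simp

lemma bij_betw_add_annihilator: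
  assumes "J \<subseteq> carrier_vec n" "u \<in> annihilator n J"
  shows "bij_betw ((+) u) (annihilator n J) (annihilator n J)"
  by (rule bij_betw_byWitness[where f' = "(+) u"])
     (use assms in \<open>auto simp: annihilator_def add_add_cancel_bit_vec subset_iff chi_add[of _ n]\<close>)

text \<open>A dependency \<open>T\<close> must involve \<open>u\<close>, as \<open>J\<close> is
  independent. Its product character is trivial, and on the annihilator all its factors other than
  \<open>chi u\<close> are already 1.\<close>

lemma dependent_char_on_annihilator:
  assumes J: "finite J" "J \<subseteq> carrier_vec n" "independent_chars n J"
    and u: "u \<in> carrier_vec n" "u \<notin> J" "\<not> independent_chars n (insert u J)"
    and v: "v \<in> annihilator n J"
  shows "chi u v = 1"
proof -
  obtain T where T: "T \<subseteq> insert u J" "T \<noteq> {}"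
    and ne: "(\<Sum>x\<in>carrier_vec n. \<Prod>w\<in>T. chi w x) \<noteq> 0"
    using u(3) unfolding independent_chars_def by blast
  have "u \<in> T"
  proof (rule ccontr)
    assume "u \<notin> T"
    then have "T \<subseteq> J" using T(1) by blast
    then show False using J(3) T(2) ne unfolding independent_chars_def by blast
  qed
  have finT: "finite T" using T(1) J(1) finite_subset by blast
  have vc: "v \<in> carrier_vec n" using v by (simp add: annihilator_def)
  have mult: "(\<Prod>w\<in>T. chi w (x + y)) = (\<Prod>w\<in>T. chi w x) * (\<Prod>w\<in>T. chi w y)"
    if "x \<in> carrier_vec n" "y \<in> carrier_vec n" for x y
  proof -
    have "(\<Prod>w\<in>T. chi w (x + y)) = (\<Prod>w\<in>T. chi w x * chi w y)"
      using T(1) J(2) u(1) that by (intro prod.cong refl chi_add) auto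
    then show ?thesis by (simp add: prod.distrib)
  qed
  \<comment> \<open>A multiplicative function with nonzero total can take no value other than
    1.\<close>
  have "(\<Prod>w\<in>T. chi w v) = 1"
    using sum_multiplicative_eq_0[of n "\<lambda>x. \<Prod>w\<in>T. chi w x" v, OF mult vc] ne by blast
  moreover have "(\<Prod>w\<in>T. chi w v) = chi u v * (\<Prod>w\<in>T - {u}. chi w v)"
    by (rule prod.remove[OF finT \<open>u \<in> T\<close>])
  moreover have "(\<Prod>w\<in>T - {u}. chi w v) = 1"
    using v T(1) by (intro prod.neutral) (auto simp: annihilator_def)
  ultimately show ?thesis by simp
qed

text \<open>An independent subset of greatest cardinality works: no further element of
  \<open>\<Gamma>\<close> can be added to it, so each one is dependent on it.\<close>

lemma ex_spanning_independent:
  assumes \<Gamma>: "\<Gamma> \<subseteq> carrier_vec n"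
  obtains J where "J \<subseteq> \<Gamma>" "independent_chars n J"
    "\<And>u v. u \<in> \<Gamma> \<Longrightarrow> v \<in> annihilator n J \<Longrightarrow> chi u v = 1"
proof -
  have fin: "finite \<Gamma>" by (rule finite_subset[OF \<Gamma>]) simp
  let ?P = "\<lambda>J. J \<subseteq> \<Gamma> \<and> independent_chars n J"
  have "?P {}" by (simp add: independent_chars_def)
  moreover have "\<forall>J. ?P J \<longrightarrow> card J < Suc (card \<Gamma>)"
    by (simp add: card_mono fin less_Suc_eq_le)
  ultimately have "\<exists>J. ?P J \<and> (\<forall>K. ?P K \<longrightarrow> card K \<le> card J)"
    by (rule ex_has_greatest_nat[where P = ?P])
  then obtain J where J: "?P J" and max: "\<And>K. ?P K \<Longrightarrow> card K \<le> card J"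
    by metis
  have finJ: "finite J" using J fin finite_subset by blast
  have "chi u v = 1" if u: "u \<in> \<Gamma>" and v: "v \<in> annihilator n J" for u v
  proof (cases "u \<in> J")
    case True
    then show ?thesis using v by (simp add: annihilator_def)
  next
    case False
    then have "\<not> independent_chars n (insert u J)"
      using max[of "insert u J"] J u finJ by auto
    then show ?thesis
      using dependent_char_on_annihilator[OF finJ _ _ _ False _ v] J u \<Gamma> by blast
  qed
  then show thesis using J that by blast
qed

section \<open>Fourier analysis of a sum of independent coordinates\<close>

lemma chi_finsum_vec:
  assumes "finite I" "u \<in> carrier_vec n" "y \<in> I \<rightarrow> carrier_vec n"
  shows "chi u (finsum_vec TYPE(bit) n y I) = (\<Prod>i\<in>I. chi u (y i))"
  using assms(1,3)
proof (induction I)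
  case empty
  then show ?case using assms(2) by (simp add: finsum_vec_empty)
next
  case (insert i I)
  then have "y \<in> I \<rightarrow> carrier_vec n" "y i \<in> carrier_vec n" by auto
  then show ?case
    using insert assms(2)
    by (simp add: finsum_vec_insert chi_add[of _ n] finsum_vec_closed)
qed

text \<open>A product of one-coordinate functions sums over a product set to the product of the
  sums. Each factor is \<open>card (A i) * bias (A i) u\<close>, also for empty
  \<open>A i\<close>.\<close>

lemma sum_chi_PiE:
  fixes m :: nat
  assumes u: "u \<in> carrier_vec n"
    and A: "\<And>i. i < m \<Longrightarrow> A i \<subseteq> carrier_vec n"
  shows "(\<Sum>y\<in>PiE {..<m} A. chi u (finsum_vec TYPE(bit) n y {..<m}))
       = card (PiE {..<m} A) * (\<Prod>i<m. bias (A i) u)"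
proof -
  have fin: "finite (A i)" if "i < m" for i
    by (rule finite_subset[OF A[OF that]]) simp
  have "(\<Sum>y\<in>PiE {..<m} A. chi u (finsum_vec TYPE(bit) n y {..<m}))
      = (\<Sum>y\<in>PiE {..<m} A. \<Prod>i<m. chi u (y i))"
  proof (rule sum.cong[OF refl])
    fix y assume "y \<in> PiE {..<m} A"
    then have "y \<in> {..<m} \<rightarrow> carrier_vec n" using A by (auto simp: PiE_iff)
    then show "chi u (finsum_vec TYPE(bit) n y {..<m}) = (\<Prod>i<m. chi u (y i))"
      by (rule chi_finsum_vec[OF finite_lessThan u])
  qed
  also have "\<dots> = (\<Prod>i<m. \<Sum>a\<in>A i. chi u a)"
    by (rule prod_sum_PiE[symmetric]) (auto simp: fin)
  also have "\<dots> = (\<Prod>i<m. card (A i) * bias (A i) u)"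
    by (intro prod.cong refl) (auto simp: bias_def fin)
  also have "\<dots> = card (PiE {..<m} A) * (\<Prod>i<m. bias (A i) u)"
    by (simp add: prod.distrib card_PiE)
  finally show ?thesis .
qed

lemma fourier_coefficient_le_1:
  fixes B :: "bit vec \<Rightarrow> real"
  assumes "\<And>x. \<bar>B x\<bar> \<le> 1"
  shows "\<bar>(\<Sum>x\<in>carrier_vec n. B x * chi u x) / 2 ^ n\<bar> \<le> 1"
proof -
  have "\<bar>\<Sum>x\<in>carrier_vec n. B x * chi u x\<bar> \<le> (\<Sum>x\<in>(carrier_vec n :: bit vec set). 1)"
    by (rule order_trans[OF sum_abs sum_mono]) (simp add: abs_mult assms)
  then show ?thesis by (simp add: card_carrier_vec_bit)
qed

text \<open>Every Fourier mode of \<open>B\<close> is either \<open>V\<close>-invariant or damped by \<open>\<delta>\<close>.\<close>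

lemma sum_PiE_almost_invariant:
  fixes B :: "bit vec \<Rightarrow> real" and m :: nat
  assumes A: "\<And>i. i < m \<Longrightarrow> A i \<subseteq> carrier_vec n"
    and V: "V \<subseteq> carrier_vec n" "V \<noteq> {}"
    and B: "\<And>x. \<bar>B x\<bar> \<le> 1"
    and \<delta>: "0 \<le> \<delta>"
    and mode: "\<And>u. u \<in> carrier_vec n \<Longrightarrow>
      (\<forall>v\<in>V. chi u v = 1) \<or> \<bar>\<Prod>i<m. bias (A i) u\<bar> \<le> \<delta>"
  shows "(\<Sum>y\<in>PiE {..<m} A. B (finsum_vec TYPE(bit) n y {..<m})
            - (\<Sum>v\<in>V. B (finsum_vec TYPE(bit) n y {..<m} + v)) / card V)
          \<le> 2 ^ (n + 1) * \<delta> * card (PiE {..<m} A)"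
proof -
  let ?S = "\<lambda>y. finsum_vec TYPE(bit) n y {..<m}"
  define b where "b u = (\<Sum>x\<in>carrier_vec n. B x * chi u x) / 2 ^ n" for u
  \<comment> \<open>Averaging over \<open>V\<close> multiplies the mode \<open>u\<close> by
    \<open>\<kappa> u\<close>, so the difference to be bounded carries the factor
    \<open>1 - \<kappa> u\<close>.\<close>
  define \<kappa> where "\<kappa> u = (\<Sum>v\<in>V. chi u v) / card V" for u
  define P where "P u = (\<Prod>i<m. bias (A i) u)" for u
  have finV: "finite V" by (rule finite_subset[OF V(1)]) simp
  then have cV: "real (card V) > 0" using V(2) by (simp add: card_gt_0_iff)
  have S: "?S y \<in> carrier_vec n" if "y \<in> PiE {..<m} A" for y
    using that A by (intro finsum_vec_closed) (auto simp: PiE_iff)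
  have inner: "B (?S y) - (\<Sum>v\<in>V. B (?S y + v)) / card V
      = (\<Sum>u\<in>carrier_vec n. b u * (1 - \<kappa> u) * chi u (?S y))" if y: "y \<in> PiE {..<m} A" for y
  proof -
    have "(\<Sum>v\<in>V. B (?S y + v)) = (\<Sum>v\<in>V. \<Sum>u\<in>carrier_vec n. b u * chi u (?S y) * chi u v)"
    proof (rule sum.cong[OF refl])
      fix v assume "v \<in> V"
      then have v: "v \<in> carrier_vec n" using V by auto
      have "B (?S y + v) = (\<Sum>u\<in>carrier_vec n. b u * chi u (?S y + v))"
        unfolding b_def by (rule fourier_expansion) (simp add: S[OF y] v)
      also have "\<dots> = (\<Sum>u\<in>carrier_vec n. b u * chi u (?S y) * chi u v)"
        by (intro sum.cong refl) (simp add: chi_add[OF _ S[OF y] v])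
      finally show "B (?S y + v) = (\<Sum>u\<in>carrier_vec n. b u * chi u (?S y) * chi u v)" .
    qed
    also have "\<dots> = (\<Sum>u\<in>carrier_vec n. b u * chi u (?S y) * (\<Sum>v\<in>V. chi u v))"
      by (subst sum.swap) (simp add: sum_distrib_left)
    also have "\<dots> = card V * (\<Sum>u\<in>carrier_vec n. b u * chi u (?S y) * \<kappa> u)"
      using cV unfolding \<kappa>_def sum_distrib_left[of "real (card V)"]
      by (intro sum.cong refl) simp
    finally have "(\<Sum>v\<in>V. B (?S y + v)) / card V
        = (\<Sum>u\<in>carrier_vec n. b u * chi u (?S y) * \<kappa> u)"
      using cV by simp
    moreover have "B (?S y) = (\<Sum>u\<in>carrier_vec n. b u * chi u (?S y))"
      unfolding b_def by (rule fourier_expansion) (rule S[OF y])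
    ultimately show ?thesis
      by (simp add: sum_subtractf[symmetric] algebra_simps)
  qed
  have "(\<Sum>y\<in>PiE {..<m} A. B (?S y) - (\<Sum>v\<in>V. B (?S y + v)) / card V)
      = (\<Sum>y\<in>PiE {..<m} A. \<Sum>u\<in>carrier_vec n. b u * (1 - \<kappa> u) * chi u (?S y))"
    by (rule sum.cong[OF refl inner])
  also have "\<dots> = (\<Sum>u\<in>carrier_vec n. b u * (1 - \<kappa> u) * (\<Sum>y\<in>PiE {..<m} A. chi u (?S y)))"
    by (subst sum.swap) (simp add: sum_distrib_left)
  also have "\<dots> = (\<Sum>u\<in>carrier_vec n. b u * (1 - \<kappa> u) * P u * card (PiE {..<m} A))"
    by (intro sum.cong refl) (simp add: sum_chi_PiE A P_def)
  \<comment> \<open>There are \<open>2 ^ n\<close> modes; in each, \<open>b u\<close> is at most 1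
    and \<open>1 - \<kappa> u\<close> at most 2 in absolute value.\<close>
  also have "\<dots> \<le> (\<Sum>u\<in>(carrier_vec n :: bit vec set). 2 * \<delta> * card (PiE {..<m} A))"
  proof (intro sum_mono mult_right_mono)
    fix u :: "bit vec" assume u: "u \<in> carrier_vec n"
    show "b u * (1 - \<kappa> u) * P u \<le> 2 * \<delta>"
    proof (cases "\<forall>v\<in>V. chi u v = 1")
      case True
      then have "\<kappa> u = 1" using cV by (simp add: \<kappa>_def)
      then show ?thesis using \<delta> by simp
    next
      case False
      then have P: "\<bar>P u\<bar> \<le> \<delta>" using mode[OF u] by (auto simp: P_def)
      have "\<bar>\<kappa> u\<bar> \<le> 1"
        using abs_bias_le_1[of V u] by (simp add: \<kappa>_def bias_def)
      then have \<kappa>: "\<bar>1 - \<kappa> u\<bar> \<le> 2" by linarith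
      have b: "\<bar>b u\<bar> \<le> 1"
        unfolding b_def by (rule fourier_coefficient_le_1[OF B])
      have "\<bar>b u * (1 - \<kappa> u) * P u\<bar> \<le> 1 * 2 * \<delta>"
        unfolding abs_mult by (intro mult_mono b \<kappa> P) auto
      then show ?thesis by linarith
    qed
  qed simp
  also have "\<dots> = 2 ^ (n + 1) * \<delta> * card (PiE {..<m} A)"
    by (simp add: card_carrier_vec_bit)
  finally show ?thesis .
qed

text \<open>
  Summing the level-one inequality over \<open>i\<close> and using \<open>\<beta>\<^sup>2 \<ge> 1 + ln (\<beta>\<^sup>2)\<close> bounds the
  spectrum of the product without singling out the dense factors.
\<close>

lemma card_independent_spectrum_le:
  fixes c :: nat
  assumes A: "\<And>i. i < m \<Longrightarrow> A i \<subseteq> carrier_vec n" "\<And>i. i < m \<Longrightarrow> A i \<noteq> {}"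
    and m: "0 < m"
    and J: "finite J" "independent_chars n J"
    and spec: "\<And>u. u \<in> J \<Longrightarrow> \<bar>\<Prod>i<m. bias (A i) u\<bar> > 2 powr (- (m / 2))"
    and dense: "2 ^ (n * m) / 2 ^ (2 * c * m) \<le> real (card (PiE {..<m} A))"
  shows "card J \<le> 10 * c"
proof -
  have fin: "finite (A i)" if "i < m" for i
    by (rule finite_subset[OF A(1)[OF that]]) simp
  have cA: "real (card (A i)) > 0" if "i < m" for i
    using fin[OF that] A(2)[OF that] by (simp add: card_gt_0_iff)
  have low: "m * (1 - ln 2) \<le> (\<Sum>i<m. (bias (A i) u)\<^sup>2)" if u: "u \<in> J" for u
  proof -
    let ?p = "\<Prod>i<m. bias (A i) u"
    \<comment> \<open>A nonzero product forces every bias to be nonzero, so the logarithm of the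
      product splits.\<close>
    have "0 < \<bar>?p\<bar>" using spec[OF u] by (smt (verit) powr_gt_zero)
    then have nz: "bias (A i) u \<noteq> 0" if "i < m" for i
      using that by auto
    have "- (m / 2) * ln 2 = ln (2 powr (- (m / 2)))" by (simp add: ln_powr)
    also have "\<dots> \<le> ln \<bar>?p\<bar>"
      using spec[OF u] by (intro ln_mono) auto
    also have "\<dots> = (\<Sum>i<m. ln \<bar>bias (A i) u\<bar>)"
      unfolding abs_prod by (rule ln_prod) (auto simp: nz)
    finally have *: "- (m * ln 2) \<le> (\<Sum>i<m. 2 * ln \<bar>bias (A i) u\<bar>)"
      by (simp add: sum_distrib_left[symmetric])
    have "(\<Sum>i<m. 1 + 2 * ln \<bar>bias (A i) u\<bar>) \<le> (\<Sum>i<m. (bias (A i) u)\<^sup>2)"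
    proof (rule sum_mono)
      fix i assume "i \<in> {..<m}"
      then have "0 < (bias (A i) u)\<^sup>2" using nz by simp
      then have "ln ((bias (A i) u)\<^sup>2) \<le> (bias (A i) u)\<^sup>2 - 1" by (rule ln_le_minus_one)
      moreover have "ln ((bias (A i) u)\<^sup>2) = 2 * ln \<bar>bias (A i) u\<bar>"
        using nz[of i] \<open>i \<in> {..<m}\<close> ln_realpow[of "\<bar>bias (A i) u\<bar>" 2] by simp
      ultimately show "1 + 2 * ln \<bar>bias (A i) u\<bar> \<le> (bias (A i) u)\<^sup>2" by linarith
    qed
    then show ?thesis using * by (simp add: sum.distrib algebra_simps)
  qed
  have "card J * (m * (1 - ln 2)) \<le> (\<Sum>u\<in>J. \<Sum>i<m. (bias (A i) u)\<^sup>2)"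
    using sum_mono[of J "\<lambda>_. m * (1 - ln 2)", OF low] by simp
  also have "\<dots> = (\<Sum>i<m. \<Sum>u\<in>J. (bias (A i) u)\<^sup>2)" by (rule sum.swap)
  also have "\<dots> \<le> (\<Sum>i<m. 2 * ln (2 ^ n / card (A i)))"
    by (intro sum_mono level_one_inequality J) (use A in auto)
  also have "\<dots> = 2 * ((n * m) * ln 2 - (\<Sum>i<m. ln (card (A i))))"
  proof -
    have "(\<Sum>i<m. 2 * ln (2 ^ n / card (A i))) = (\<Sum>i<m. 2 * (n * ln 2 - ln (card (A i))))"
      using cA by (intro sum.cong refl) (auto simp: ln_div ln_realpow)
    then show ?thesis
      by (simp add: sum_distrib_left[symmetric] sum_subtractf)
  qed
  also have "(\<Sum>i<m. ln (card (A i))) = ln (card (PiE {..<m} A))"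
    by (simp add: card_PiE, rule ln_prod[symmetric]) (use cA in fastforce)+
  \<comment> \<open>The density assumption allows a total deficit of \<open>2 * c * m\<close> bits
    over all coordinates.\<close>
  also have "2 * ((n * m) * ln 2 - ln (card (PiE {..<m} A))) \<le> 4 * c * m * ln 2"
  proof -
    have "ln ((2::real) ^ (n * m) / 2 ^ (2 * c * m)) \<le> ln (card (PiE {..<m} A))"
      using dense by (intro ln_mono) auto
    then show ?thesis by (simp add: ln_div ln_realpow)
  qed
  finally have "m * (card J * (1 - ln 2)) \<le> m * (4 * c * ln 2)"
    by (simp add: mult_ac)
  then have *: "card J * (1 - ln 2) \<le> 4 * c * ln 2"
    using m by simp
  \<comment> \<open>With \<open>ln 2 \<le> 25 / 36\<close> the ratio of \<open>4 * ln 2\<close> to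
    \<open>1 - ln 2\<close> is at most 100/11, which is below the stated 10.\<close>
  have "card J * (11 / 36) \<le> card J * (1 - ln 2)"
    using ln2_le_25_over_36 by (intro mult_left_mono) auto
  also note *
  also have "4 * c * ln 2 \<le> 4 * c * (25 / 36)"
    using ln2_le_25_over_36 by (intro mult_left_mono) auto
  finally show ?thesis by linarith
qed

text \<open>The two error terms serve the two cases: a small box is bounded trivially by its size,
  and in a large box \<open>J\<close> spans the large spectrum. \<open>J\<close> does not depend on
  \<open>B\<close>, so one space serves all inputs and output values.\<close>

lemma ex_invariance_space:
  fixes c :: nat
  assumes A: "\<And>i. i < m \<Longrightarrow> A i \<subseteq> carrier_vec n" and m: "0 < m"
  obtains J where "J \<subseteq> carrier_vec n" "card J \<le> 10 * c"
    "\<And>B :: bit vec \<Rightarrow> real. (\<And>x. 0 \<le> B x \<and> B x \<le> 1) \<Longrightarrow>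
       (\<Sum>y\<in>PiE {..<m} A. B (finsum_vec TYPE(bit) n y {..<m})
          - (\<Sum>v\<in>annihilator n J. B (finsum_vec TYPE(bit) n y {..<m} + v)) / card (annihilator n J))
        \<le> 2 ^ (n + 1) * 2 powr (- (m / 2)) * card (PiE {..<m} A) + 2 ^ (n * m) / 2 ^ (2 * c * m)"
proof (cases "2 ^ (n * m) / 2 ^ (2 * c * m) \<le> real (card (PiE {..<m} A))")
  case False
  \<comment> \<open>For a small box the empty \<open>J\<close> suffices: every summand is at most
    1.\<close>
  show thesis
  proof (rule that[of "{}"])
    fix B :: "bit vec \<Rightarrow> real" assume B: "\<And>x. 0 \<le> B x \<and> B x \<le> 1"
    let ?S = "\<lambda>y. finsum_vec TYPE(bit) n y {..<m}"
    have "(\<Sum>y\<in>PiE {..<m} A. B (?S y)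
          - (\<Sum>v\<in>annihilator n {}. B (?S y + v)) / card (annihilator n {}))
        \<le> (\<Sum>y\<in>PiE {..<m} A. 1)"
    proof (rule sum_mono)
      fix y
      have "0 \<le> (\<Sum>v\<in>annihilator n {}. B (?S y + v)) / card (annihilator n {})"
        by (intro divide_nonneg_nonneg sum_nonneg) (auto simp: B)
      then show "B (?S y) - (\<Sum>v\<in>annihilator n {}. B (?S y + v)) / card (annihilator n {}) \<le> 1"
        using B[of "?S y"] by linarith
    qed
    also have "\<dots> \<le> 2 ^ (n + 1) * 2 powr (- (m / 2)) * card (PiE {..<m} A)
        + 2 ^ (n * m) / 2 ^ (2 * c * m)"
      using False by (simp add: add_increasing)
    finally show "(\<Sum>y\<in>PiE {..<m} A. B (?S y)
          - (\<Sum>v\<in>annihilator n {}. B (?S y + v)) / card (annihilator n {}))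
        \<le> 2 ^ (n + 1) * 2 powr (- (m / 2)) * card (PiE {..<m} A)
          + 2 ^ (n * m) / 2 ^ (2 * c * m)" .
  qed auto
next
  case True
  have "0 < (2::real) ^ (n * m) / 2 ^ (2 * c * m)" by simp
  then have "PiE {..<m} A \<noteq> {}" using True by (metis card.empty of_nat_0 not_less)
  then have ne: "A i \<noteq> {}" if "i < m" for i using that by (auto simp: PiE_eq_empty_iff)
  \<comment> \<open>The threshold is low enough to beat the number of modes in the final estimate,
    yet a character above it still has mean squared bias at least \<open>1 - ln 2\<close> over the
    coordinates.\<close>
  define \<Gamma> where "\<Gamma> = {u \<in> carrier_vec n. \<bar>\<Prod>i<m. bias (A i) u\<bar> > 2 powr (- (m / 2))}"
  have "\<Gamma> \<subseteq> carrier_vec n" by (auto simp: \<Gamma>_def)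
  then obtain J where J: "J \<subseteq> \<Gamma>" "independent_chars n J"
    and span: "\<And>u v. u \<in> \<Gamma> \<Longrightarrow> v \<in> annihilator n J \<Longrightarrow> chi u v = 1"
    using ex_spanning_independent by metis
  have JG: "J \<subseteq> carrier_vec n" using J(1) by (auto simp: \<Gamma>_def)
  then have finJ: "finite J" by (rule finite_subset) simp
  show thesis
  proof (rule that[of J, OF JG])
    show "card J \<le> 10 * c"
      using card_independent_spectrum_le[OF A ne m finJ J(2) _ True] J(1) by (auto simp: \<Gamma>_def)
    fix B :: "bit vec \<Rightarrow> real" assume B: "\<And>x. 0 \<le> B x \<and> B x \<le> 1"
    let ?S = "\<lambda>y. finsum_vec TYPE(bit) n y {..<m}"
    have "(\<Sum>y\<in>PiE {..<m} A. B (?S y)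
          - (\<Sum>v\<in>annihilator n J. B (?S y + v)) / card (annihilator n J))
        \<le> 2 ^ (n + 1) * 2 powr (- (m / 2)) * card (PiE {..<m} A)"
    proof (rule sum_PiE_almost_invariant[OF A annihilator_subset])
      show "annihilator n J \<noteq> {}" using zero_mem_annihilator[OF JG] by blast
      show "\<bar>B x\<bar> \<le> 1" for x using B[of x] by simp
      show "(\<forall>v\<in>annihilator n J. chi u v = 1) \<or> \<bar>\<Prod>i<m. bias (A i) u\<bar> \<le> 2 powr (- (m / 2))"
        if "u \<in> carrier_vec n" for u
        using span[of u] that by (force simp: \<Gamma>_def)
    qed auto
    also have "\<dots> \<le> 2 ^ (n + 1) * 2 powr (- (m / 2)) * card (PiE {..<m} A)
        + 2 ^ (n * m) / 2 ^ (2 * c * m)" by simp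
    finally show "(\<Sum>y\<in>PiE {..<m} A. B (?S y)
          - (\<Sum>v\<in>annihilator n J. B (?S y + v)) / card (annihilator n J))
        \<le> 2 ^ (n + 1) * 2 powr (- (m / 2)) * card (PiE {..<m} A)
          + 2 ^ (n * m) / 2 ^ (2 * c * m)" .
  qed
qed

section \<open>The sketch of a deterministic protocol\<close>

lemma linear_functional_scalar_prod:
  "u \<in> carrier_vec n \<Longrightarrow> linear_functional n ((\<bullet>) u)"
  by (auto simp: linear_functional_def scalar_prod_add_distrib[of _ n])

text \<open>The functionals enumerate \<open>J\<close> and are padded with zero up to
  \<open>k\<close>. The decoder \<open>h\<close> evaluates \<open>g\<close> at any preimage of the
  vector of values; invariance of \<open>g\<close> makes the choice immaterial.\<close>

lemma linear_juntaI:
  assumes J: "J \<subseteq> carrier_vec n" "card J \<le> k"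
    and g: "\<And>x y. x \<in> carrier_vec n \<Longrightarrow> y \<in> carrier_vec n \<Longrightarrow>
      (\<forall>u\<in>J. chi u x = chi u y) \<Longrightarrow> g x = g y"
  shows "linear_junta n k g"
proof -
  have "finite J" by (rule finite_subset[OF J(1)]) simp
  then obtain e where e: "bij_betw e {0..<card J} J"
    using ex_bij_betw_nat_finite by blast
  define l where "l i = (\<bullet>) (if i < card J then e i else 0\<^sub>v n)" for i
  define h where "h w = g (SOME z. z \<in> carrier_vec n \<and> vec k (\<lambda>i. l i z) = w)" for w
  have eJ: "e i \<in> J" if "i < card J" for i
    using e that by (auto simp: bij_betw_def)
  have "\<forall>i<k. linear_functional n (l i)"
    using eJ J(1) by (auto simp: l_def intro!: linear_functional_scalar_prod)
  moreover have "g x = h (vec k (\<lambda>i. l i x))" if x: "x \<in> carrier_vec n" for x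
  proof -
    define z where "z = (SOME z. z \<in> carrier_vec n \<and> vec k (\<lambda>i. l i z) = vec k (\<lambda>i. l i x))"
    have z: "z \<in> carrier_vec n" "vec k (\<lambda>i. l i z) = vec k (\<lambda>i. l i x)"
      using someI[of "\<lambda>z. z \<in> carrier_vec n \<and> vec k (\<lambda>i. l i z) = vec k (\<lambda>i. l i x)" x] x
      by (simp_all add: z_def)
    have "chi u x = chi u z" if u: "u \<in> J" for u
    proof -
      obtain i where i: "i < card J" "u = e i"
        using e u unfolding bij_betw_def by (metis atLeastLessThan_iff imageE)
      then have "vec k (\<lambda>i. l i z) $ i = vec k (\<lambda>i. l i x) $ i" using z(2) by simp
      then have "u \<bullet> z = u \<bullet> x" using i J(2) by (simp add: l_def)
      then show ?thesis by (simp add: chi_def)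
    qed
    then have "g x = g z" using g[OF x z(1)] by blast
    then show ?thesis by (simp add: h_def z_def)
  qed
  ultimately show ?thesis unfolding linear_junta_def by blast
qed

lemma prob_bind_pmf_of_set:
  assumes "finite A" "A \<noteq> {}"
  shows "measure_pmf.prob (pmf_of_set A \<bind> f) E = (\<Sum>a\<in>A. measure_pmf.prob (f a) E) / card A"
proof -
  have "ennreal (measure_pmf.prob (pmf_of_set A \<bind> f) E)
      = (\<Sum>a\<in>A. ennreal (measure_pmf.prob (f a) E)) / card A"
    by (simp add: measure_pmf.emeasure_eq_measure[symmetric] nn_integral_pmf_of_set assms)
  also have "\<dots> = ennreal ((\<Sum>a\<in>A. measure_pmf.prob (f a) E) / card A)"
    using assms by (simp add: sum_ennreal divide_ennreal[symmetric] sum_nonneg card_gt_0_iff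
        ennreal_of_nat_eq_real_of_nat)
  finally show ?thesis by (simp add: sum_nonneg)
qed

lemma prob_map_pmf_of_set:
  assumes "finite V" "V \<noteq> {}"
  shows "measure_pmf.prob (map_pmf h (pmf_of_set V)) E = (\<Sum>v\<in>V. of_bool (h v \<in> E)) / card V"
proof -
  have "V \<inter> h -` E = {v \<in> V. h v \<in> E}" by auto
  then show ?thesis
    using assms by (simp add: measure_pmf_of_set Int_def)
qed

text \<open>Depends on \<open>x\<close> only through the values at \<open>x\<close> of the characters in \<open>J\<close>.\<close>

definition coset_rep :: "nat \<Rightarrow> bit vec set \<Rightarrow> bit vec \<Rightarrow> bit vec" where
  "coset_rep n J x = (SOME z. z \<in> carrier_vec n \<and> (\<forall>u\<in>J. chi u z = chi u x))"

lemma coset_rep: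
  assumes "x \<in> carrier_vec n"
  shows "coset_rep n J x \<in> carrier_vec n" "u \<in> J \<Longrightarrow> chi u (coset_rep n J x) = chi u x"
  using someI[of "\<lambda>z. z \<in> carrier_vec n \<and> (\<forall>u\<in>J. chi u z = chi u x)" x] assms
  by (auto simp: coset_rep_def)

lemma coset_rep_cong:
  "(\<And>u. u \<in> J \<Longrightarrow> chi u x = chi u y) \<Longrightarrow> coset_rep n J x = coset_rep n J y"
  by (simp add: coset_rep_def)

text \<open>\<open>x\<close> and its representative differ by an element \<open>u\<close> of the
  annihilator, and shifting the summation variable by \<open>u\<close> absorbs it. Thus a sketch
  that sees only the coset has the average belonging to \<open>x\<close> itself.\<close>

lemma sum_coset_rep:
  assumes J: "J \<subseteq> carrier_vec n" and x: "x \<in> carrier_vec n" and s: "s \<in> carrier_vec n"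
  shows "(\<Sum>v\<in>annihilator n J. B (coset_rep n J x + s + v)) = (\<Sum>v\<in>annihilator n J. B (x + (s + v)))"
proof -
  note rep = coset_rep[OF x]
  define u where "u = x + coset_rep n J x"
  have u: "u \<in> annihilator n J"
    using J x rep by (auto simp: u_def annihilator_def chi_add[of _ n] subset_iff)
  have "(\<Sum>v\<in>annihilator n J. B (coset_rep n J x + s + v))
      = (\<Sum>v\<in>annihilator n J. B (coset_rep n J x + s + (u + v)))"
    by (rule sum.reindex_bij_betw[symmetric, OF bij_betw_add_annihilator[OF J u]])
  also have "\<dots> = (\<Sum>v\<in>annihilator n J. B (x + (s + v)))"
  proof (rule sum.cong[OF refl])
    fix v assume "v \<in> annihilator n J"
    then have v: "v \<in> carrier_vec n" by (simp add: annihilator_def)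
    have "coset_rep n J x + s + (u + v) = x + (s + v)"
    proof (rule eq_vecI)
      fix i assume "i < dim_vec (x + (s + v))"
      then have i: "i < n" using v by simp
      \<comment> \<open>The representative's coordinate \<open>a\<close> occurs twice and cancels in
        characteristic two.\<close>
      have "a + b + (c + a + d) = c + (b + d)" for a b c d :: bit
      proof -
        have "a + b + (c + a + d) = (a + a) + (c + (b + d))" by (simp only: ac_simps)
        then show ?thesis by (cases "a = 0") simp_all
      qed
      then show "(coset_rep n J x + s + (u + v)) $ i = (x + (s + v)) $ i"
        using i rep(1)[of J] x s v unfolding u_def
        by (simp only: index_add_vec carrier_vecD)
    qed (use v x s in \<open>simp add: u_def\<close>)
    then show "B (coset_rep n J x + s + (u + v)) = B (x + (s + v))" by simp
  qed
  finally show ?thesis .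
qed

text \<open>The sketch draws \<open>y\<close> uniformly, then \<open>v\<close> in the annihilator
  attached to the label \<open>tr y\<close>, and runs \<open>out\<close> on the representative of
  \<open>x\<close> shifted by the sum of \<open>y\<close> and by \<open>v\<close>. Only two facts
  about transcripts enter: there are few labels, and their fibres are boxes.\<close>

lemma ex_sketch_deterministic:
  fixes tr :: "(nat \<Rightarrow> bit vec) \<Rightarrow> 'l" and out :: "'l \<Rightarrow> bit vec \<Rightarrow> bool" and c m n :: nat
  defines "X \<equiv> PiE {..<m} (\<lambda>_. carrier_vec n)"
  assumes m: "0 < m"
    and L: "finite L" "card L \<le> 2 ^ (c * m)" "\<And>y. y \<in> X \<Longrightarrow> tr y \<in> L"
    and box: "\<And>l. l \<in> L \<Longrightarrow> \<exists>A. (\<forall>i<m. A i \<subseteq> carrier_vec n) \<and> {y \<in> X. tr y = l} = PiE {..<m} A"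
  obtains G where "linear_sketch n (10 * c) G"
    "\<And>x b. x \<in> carrier_vec n \<Longrightarrow> measure_pmf.prob G {g. g x = b}
       \<ge> (\<Sum>y\<in>X. of_bool (out (tr y) (x + finsum_vec TYPE(bit) n y {..<m}) = b)) / card X
         - (2 ^ (n + 1) * 2 powr (- (m / 2)) + 1 / 2 ^ (c * m))"
proof -
  let ?S = "\<lambda>y. finsum_vec TYPE(bit) n y {..<m}"
  let ?\<epsilon> = "2 ^ (n + 1) * 2 powr (- (m / 2)) :: real"
  \<comment> \<open>Stating the bound for all \<open>B\<close> at once lets \<open>J\<close> be
    chosen per label, before \<open>x\<close> and \<open>b\<close> are fixed.\<close>
  define Q where "Q l J \<longleftrightarrow> J \<subseteq> carrier_vec n \<and> card J \<le> 10 * c \<and>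
     (\<forall>B :: bit vec \<Rightarrow> real. (\<forall>x. 0 \<le> B x \<and> B x \<le> 1) \<longrightarrow>
       (\<Sum>y\<in>{y \<in> X. tr y = l}. B (?S y)
          - (\<Sum>v\<in>annihilator n J. B (?S y + v)) / card (annihilator n J))
        \<le> ?\<epsilon> * card {y \<in> X. tr y = l} + 2 ^ (n * m) / 2 ^ (2 * c * m))" for l J
  have "\<exists>J. Q l J" if l: "l \<in> L" for l
  proof -
    obtain A where A: "\<And>i. i < m \<Longrightarrow> A i \<subseteq> carrier_vec n" "{y \<in> X. tr y = l} = PiE {..<m} A"
      using box[OF l] by blast
    show ?thesis
      unfolding Q_def A(2) by (rule ex_invariance_space[where c = c, OF A(1) m]) blast+
  qed
  then obtain J where Q: "\<And>l. l \<in> L \<Longrightarrow> Q l (J l)"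
    by metis
  have J: "J l \<subseteq> carrier_vec n" "card (J l) \<le> 10 * c" if "l \<in> L" for l
    using Q[OF that] unfolding Q_def by blast+
  have inv: "(\<Sum>y\<in>{y \<in> X. tr y = l}. B (?S y)
          - (\<Sum>v\<in>annihilator n (J l). B (?S y + v)) / card (annihilator n (J l)))
        \<le> ?\<epsilon> * card {y \<in> X. tr y = l} + 2 ^ (n * m) / 2 ^ (2 * c * m)"
    if "l \<in> L" "\<And>x. 0 \<le> B x \<and> B x \<le> 1" for l and B :: "bit vec \<Rightarrow> real"
    using Q[OF that(1)] that(2) unfolding Q_def by blast
  have finX: "finite X" unfolding X_def by (intro finite_PiE) auto
  have neX: "X \<noteq> {}" unfolding X_def by (auto simp: PiE_eq_empty_iff intro: zero_carrier_vec)
  have cX: "real (card X) = 2 ^ (n * m)"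
    by (simp add: X_def card_PiE card_carrier_vec_bit power_mult)
  have S: "?S y \<in> carrier_vec n" if "y \<in> X" for y
    using that unfolding X_def by (intro finsum_vec_closed) (auto simp: PiE_iff)
  define V where "V y = annihilator n (J (tr y))" for y
  have V: "finite (V y)" "V y \<noteq> {}" if "y \<in> X" for y
    using zero_mem_annihilator[OF J(1)[OF L(3)[OF that]]] by (auto simp: V_def)
  define g where "g y v x = out (tr y) (coset_rep n (J (tr y)) x + ?S y + v)" for y v x
  define G where "G = pmf_of_set X \<bind> (\<lambda>y. map_pmf (g y) (pmf_of_set (V y)))"
  show thesis
  proof (rule that[of G])
    show "linear_sketch n (10 * c) G"
      unfolding linear_sketch_def
    proof
      fix h assume "h \<in> set_pmf G"
      then obtain y v where y: "y \<in> X" and h: "h = g y v"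
        unfolding G_def using finX neX V by auto
      show "linear_junta n (10 * c) h"
      proof (rule linear_juntaI[OF J(1)[OF L(3)[OF y]] J(2)[OF L(3)[OF y]]])
        fix x x' assume "\<forall>u\<in>J (tr y). chi u x = chi u x'"
        then show "h x = h x'"
          using coset_rep_cong[of "J (tr y)" x x' n] by (simp add: h g_def)
      qed
    qed
  next
    fix x b assume x: "(x :: bit vec) \<in> carrier_vec n"
    define B where "B l z = (of_bool (out l (x + z) = b) :: real)" for l z
    have prob: "measure_pmf.prob G {g. g x = b}
        = (\<Sum>y\<in>X. (\<Sum>v\<in>V y. B (tr y) (?S y + v)) / card (V y)) / card X"
    proof -
      have "measure_pmf.prob (map_pmf (g y) (pmf_of_set (V y))) {g. g x = b}
          = (\<Sum>v\<in>V y. B (tr y) (?S y + v)) / card (V y)" if y: "y \<in> X" for y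
        using sum_coset_rep[OF J(1)[OF L(3)[OF y]] x S[OF y],
            of "\<lambda>z. of_bool (out (tr y) z = b) :: real"]
        unfolding prob_map_pmf_of_set[OF V[OF y]] by (simp add: g_def B_def V_def)
      then show ?thesis
        by (simp add: G_def prob_bind_pmf_of_set[OF finX neX])
    qed
    \<comment> \<open>Grouping by label makes both \<open>J\<close> and the tested function constant
      on each group.\<close>
    have "(\<Sum>y\<in>X. B (tr y) (?S y) - (\<Sum>v\<in>V y. B (tr y) (?S y + v)) / card (V y))
        = (\<Sum>l\<in>L. \<Sum>y\<in>{y \<in> X. tr y = l}.
            B (tr y) (?S y) - (\<Sum>v\<in>V y. B (tr y) (?S y + v)) / card (V y))"
      by (rule sum.group[symmetric]) (use finX L in auto)
    also have "\<dots> = (\<Sum>l\<in>L. \<Sum>y\<in>{y \<in> X. tr y = l}. B l (?S y)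
          - (\<Sum>v\<in>annihilator n (J l). B l (?S y + v)) / card (annihilator n (J l)))"
      by (intro sum.cong refl) (auto simp: V_def)
    also have "\<dots> \<le> (\<Sum>l\<in>L. ?\<epsilon> * card {y \<in> X. tr y = l} + 2 ^ (n * m) / 2 ^ (2 * c * m))"
      by (intro sum_mono inv) (auto simp: B_def)
    also have "\<dots> = ?\<epsilon> * (\<Sum>l\<in>L. \<Sum>y\<in>{y \<in> X. tr y = l}. 1) + card L * (2 ^ (n * m) / 2 ^ (2 * c * m))"
      by (simp add: sum.distrib sum_distrib_left)
    also have "(\<Sum>l\<in>L. \<Sum>y\<in>{y \<in> X. tr y = l}. 1) = (\<Sum>y\<in>X. 1 :: real)"
      by (rule sum.group) (use finX L in auto)
    also have "?\<epsilon> * (\<Sum>y\<in>X. 1) + card L * (2 ^ (n * m) / 2 ^ (2 * c * m))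
        \<le> ?\<epsilon> * card X + 2 ^ (c * m) * (2 ^ (n * m) / 2 ^ (2 * c * m))"
    proof -
      have "real (card L) \<le> 2 ^ (c * m)"
        using of_nat_mono[OF L(2), where 'a = real] by simp
      then have "card L * (2 ^ (n * m) / 2 ^ (2 * c * m))
          \<le> 2 ^ (c * m) * (2 ^ (n * m) / 2 ^ (2 * c * m) :: real)"
        by (rule mult_right_mono) simp
      then show ?thesis by simp
    qed
    \<comment> \<open>At most \<open>2 ^ (c * m)\<close> labels, each losing a fraction
      \<open>1 / 2 ^ (2 * c * m)\<close> of \<open>X\<close>, lose \<open>1 / 2 ^ (c * m)\<close>
      together.\<close>
    also have "\<dots> = (?\<epsilon> + 1 / 2 ^ (c * m)) * card X"
    proof -
      have "(2::real) ^ (2 * c * m) = 2 ^ (c * m) * 2 ^ (c * m)"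
        by (simp add: power_add[symmetric] mult_2 algebra_simps)
      then show ?thesis by (simp add: cX distrib_right)
    qed
    finally have "(\<Sum>y\<in>X. B (tr y) (?S y)) - (\<Sum>y\<in>X. (\<Sum>v\<in>V y. B (tr y) (?S y + v)) / card (V y))
        \<le> (?\<epsilon> + 1 / 2 ^ (c * m)) * card X"
      by (simp add: sum_subtractf)
    then have "((\<Sum>y\<in>X. B (tr y) (?S y)) - (\<Sum>y\<in>X. (\<Sum>v\<in>V y. B (tr y) (?S y + v)) / card (V y)))
        / card X \<le> ?\<epsilon> + 1 / 2 ^ (c * m)"
      using finX neX by (simp add: pos_divide_le_eq card_gt_0_iff)
    then show "(\<Sum>y\<in>X. of_bool (out (tr y) (x + ?S y) = b)) / card X - (?\<epsilon> + 1 / 2 ^ (c * m))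
        \<le> measure_pmf.prob G {g. g x = b}"
      unfolding prob by (simp add: diff_divide_distrib B_def)
  qed
qed

section \<open>Transcripts and the randomised sketch\<close>

lemma transcript_eq_iff:
  "transcript P x r m = t \<longleftrightarrow>
     length t = m \<and> (\<forall>i<m. message P i (x i) (take i t) r = t ! i)"
proof (induction m arbitrary: t)
  case 0
  then show ?case by auto
next
  case (Suc m)
  show ?case
  proof (cases t rule: rev_cases)
    case Nil
    then show ?thesis by simp
  next
    case (snoc s a)
    have "transcript P x r (Suc m) = t \<longleftrightarrow>
        transcript P x r m = s \<and> message P m (x m) s r = a"
      by (auto simp: snoc)
    also have "\<dots> \<longleftrightarrow> length t = Suc m \<and> (\<forall>i<Suc m. message P i (x i) (take i t) r = t ! i)"
      unfolding Suc.IH by (auto simp: snoc less_Suc_eq nth_append)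
    finally show ?thesis .
  qed
qed

lemma length_transcript [simp]: "length (transcript P x r m) = m"
  using transcript_eq_iff by blast

lemma transcript_cong:
  "(\<And>i. i < m \<Longrightarrow> x i = y i) \<Longrightarrow> transcript P x r m = transcript P y r m"
  by (induction m) simp_all

text \<open>Fixing the transcript fixes the history each player sees, so each message becomes a
  condition on that player's input alone.\<close>

lemma transcript_fibre_box:
  assumes "length t = m"
  shows "{y \<in> PiE {..<m} (\<lambda>_. D). transcript P y r m = t}
       = PiE {..<m} (\<lambda>i. {a \<in> D. message P i a (take i t) r = t ! i})"
  by (intro Set.set_eqI) (simp add: transcript_eq_iff PiE_iff assms, blast)

lemma bitstrings_eq: "bitstrings k = {s. set s \<subseteq> UNIV \<and> length s = k}"
  by (simp add: bitstrings_def)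

lemma finite_bitstrings [simp]: "finite (bitstrings k)"
  unfolding bitstrings_eq by (rule finite_lists_length_eq) simp

lemma card_bitstrings: "card (bitstrings k) = 2 ^ k"
  unfolding bitstrings_eq by (subst card_lists_length_eq) simp_all

lemma bitstrings_nonempty [simp]: "bitstrings k \<noteq> {}"
  using card_bitstrings[of k] by (metis card.empty power_not_zero zero_neq_numeral)

text \<open>The cost condition speaks only about well-formed histories, so well-formedness is
  carried along the induction.\<close>

lemma set_transcript_subset:
  assumes P: "protocol_with_cost n N c P" and r: "r \<in> bitstrings (rand_len P)"
    and x: "\<And>i. i < m \<Longrightarrow> x i \<in> carrier_vec n" and m: "m \<le> N - 1"
  shows "set (transcript P x r m) \<subseteq> bitstrings c"
  using x m
proof (induction m)
  case (Suc m)
  then have "set (transcript P x r m) \<subseteq> bitstrings c" by simp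
  moreover from this have "message P m (x m) (transcript P x r m) r \<in> bitstrings c"
    using P r Suc.prems unfolding protocol_with_cost_def by simp
  ultimately show ?case by simp
qed simp

section \<open>Choice of the exponent and assembly of the sketch\<close>

lemma error_bound:
  fixes n N c :: nat
  assumes n: "0 < n" and c: "0 < c" and N: "10 * n \<le> N"
  shows "2 ^ (n + 1) * 2 powr (- (real (N - 1) / 2)) + 1 / 2 ^ (c * (N - 1))
       \<le> 2 powr (- (1 / 10) * real N)"
proof -
  define m where "m = real (N - 1)"
  have Nm: "real N = m + 1" using n N by (simp add: m_def)
  have nm: "9 * real n \<le> m" "9 \<le> m" using n N by (simp_all add: m_def)
  have "(2::real) ^ (n + 1) = 2 powr real (n + 1)"
    by (rule powr_realpow[symmetric]) simp
  then have "(2::real) ^ (n + 1) * 2 powr (- (m / 2)) = 2 powr (real n + 1 - m / 2)"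
    by (simp only: powr_add[symmetric]) (simp add: add.commute)
  \<comment> \<open>This exponent is \<open>- N / 10 - 1\<close>, so each of the two error terms
    takes half of the allowance.\<close>
  also have "\<dots> \<le> 2 powr (- (m / 10) - 1 - 1 / 10)"
    by (rule powr_mono) (use nm in auto)
  finally have 1: "(2::real) ^ (n + 1) * 2 powr (- (m / 2)) \<le> 2 powr (- (m / 10) - 1 - 1 / 10)" .
  have "(2::real) ^ (N - 1) \<le> 2 ^ (c * (N - 1))"
    by (rule power_increasing) (use c in auto)
  then have "1 / 2 ^ (c * (N - 1)) \<le> 1 / (2::real) ^ (N - 1)"
    by (intro divide_left_mono) auto
  also have "\<dots> = 2 powr (- m)"
    by (simp add: m_def powr_minus powr_realpow divide_inverse)
  also have "\<dots> \<le> 2 powr (- (m / 10) - 1 - 1 / 10)"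
    by (rule powr_mono) (use nm in auto)
  finally have "2 ^ (n + 1) * 2 powr (- (m / 2)) + 1 / 2 ^ (c * (N - 1))
      \<le> 2 * (2::real) powr (- (m / 10) - 1 - 1 / 10)"
    using 1 by linarith
  also have "\<dots> = 2 powr (1 + (- (m / 10) - 1 - 1 / 10))"
    by (subst powr_add) simp
  also have "1 + (- (m / 10) - 1 - 1 / 10) = - (1 / 10) * real N"
    by (simp add: Nm field_simps)
  finally show ?thesis by (simp add: m_def)
qed

text \<open>Giving the last player \<open>x + S\<close> makes the total \<open>x + S + S\<close>,
  and \<open>S\<close> cancels itself in characteristic two.\<close>

lemma finsum_vec_complete:
  assumes y: "y \<in> PiE {..<m} (\<lambda>_. carrier_vec n)" and x: "x \<in> carrier_vec n"
  defines "S \<equiv> finsum_vec TYPE(bit) n y {..<m}"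
  shows "finsum_vec TYPE(bit) n (y(m := x + S)) {..<Suc m} = x"
proof -
  have y': "y \<in> {..<m} \<rightarrow> carrier_vec n" using y by (auto simp: PiE_iff)
  have S: "S \<in> carrier_vec n" unfolding S_def by (rule finsum_vec_closed[OF y'])
  have "finsum_vec TYPE(bit) n (y(m := x + S)) {..<m} = S"
  proof (rule eq_vecI)
    have upd: "y(m := x + S) \<in> {..<m} \<rightarrow> carrier_vec n" using y' by auto
    fix i assume "i < dim_vec S"
    then have "i < n" using S by simp
    then show "finsum_vec TYPE(bit) n (y(m := x + S)) {..<m} $ i = S $ i"
      using y' upd by (simp add: S_def index_finsum_vec)
  next
    have "y(m := x + S) \<in> {..<m} \<rightarrow> carrier_vec n" using y' by auto
    then have "finsum_vec TYPE(bit) n (y(m := x + S)) {..<m} \<in> carrier_vec n"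
      by (rule finsum_vec_closed)
    then show "dim_vec (finsum_vec TYPE(bit) n (y(m := x + S)) {..<m}) = dim_vec S"
      using S by simp
  qed
  moreover have "finsum_vec TYPE(bit) n (y(m := x + S)) (insert m {..<m})
      = (y(m := x + S)) m + finsum_vec TYPE(bit) n (y(m := x + S)) {..<m}"
    by (rule finsum_vec_insert) (use x S y' in auto)
  ultimately show ?thesis
    using x S by (simp add: lessThan_Suc assoc_add_vec)
qed

theorem theorem2p1:
  shows "\<exists>(C::real) (\<alpha>::real). C > 0 \<and> \<alpha> > 0 \<and>
    (\<forall>(n::nat) (N::nat) (c::nat) (f :: bit vec \<Rightarrow> bool)
       (F :: (nat \<Rightarrow> bit vec) \<Rightarrow> bool) (q::real).
       n > 0 \<longrightarrow> N > 0 \<longrightarrow> c > 0 \<longrightarrow> N \<ge> 10 * n \<longrightarrow>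
       (\<forall>x. (\<forall>i<N. x i \<in> carrier_vec n) \<longrightarrow>
          F x = f (finsum_vec TYPE(bit) n x {..<N})) \<longrightarrow>
       has_broadcast_protocol n N c F q \<longrightarrow>
       (\<exists>(k::nat) (G :: (bit vec \<Rightarrow> bool) pmf).
          real k \<le> C * real c \<and> linear_sketch n k G \<and>
          sketch_computes n G f (q - 2 powr (- \<alpha> * real N))))"
proof (rule exI[of _ 10], rule exI[of _ "1 / 10"], intro conjI allI impI)
  \<comment> \<open>The witness \<open>10\<close> is the factor in the bound on independent large
    characters; \<open>1 / 10\<close> is the exponent of \<open>error_bound\<close>.\<close>
  fix n N c :: nat and f :: "bit vec \<Rightarrow> bool" and F :: "(nat \<Rightarrow> bit vec) \<Rightarrow> bool" and q :: real
  assume n: "0 < n" and "0 < N" and c: "0 < c" and N: "10 * n \<le> N"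
    and F: "\<forall>x. (\<forall>i<N. x i \<in> carrier_vec n) \<longrightarrow> F x = f (finsum_vec TYPE(bit) n x {..<N})"
    and "has_broadcast_protocol n N c F q"
  then obtain P where cost: "protocol_with_cost n N c P" and comp: "protocol_computes n N P F q"
    by (auto simp: has_broadcast_protocol_def)
  \<comment> \<open>The last player sends the output, so only \<open>m\<close> messages enter the
    transcript.\<close>
  define m where "m = N - 1"
  have m: "0 < m" "N = Suc m" using n N by (auto simp: m_def)
  define R where "R = bitstrings (rand_len P)"
  define X where "X = PiE {..<m} (\<lambda>_. carrier_vec n :: bit vec set)"
  define L where "L = {t. set t \<subseteq> bitstrings c \<and> length t = m}"
  define \<epsilon> where "\<epsilon> = 2 ^ (n + 1) * 2 powr (- (real m / 2)) + 1 / 2 ^ (c * m)"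
  let ?S = "\<lambda>y. finsum_vec TYPE(bit) n y {..<m}"
  let ?out = "\<lambda>r x y. output_bit P (x + ?S y) (transcript P y r m) r"
  have R: "finite R" "R \<noteq> {}" by (simp_all add: R_def)
  have X: "finite X" "X \<noteq> {}"
    unfolding X_def by (auto intro!: finite_PiE simp: PiE_eq_empty_iff intro: zero_carrier_vec)
  define Q where "Q r G \<longleftrightarrow> linear_sketch n (10 * c) G \<and>
      (\<forall>x b. x \<in> carrier_vec n \<longrightarrow>
        measure_pmf.prob G {g. g x = b} \<ge> (\<Sum>y\<in>X. of_bool (?out r x y = b)) / card X - \<epsilon>)"
    for r G
  have "\<exists>G. Q r G" if r: "r \<in> R" for r
  proof -
    have L: "finite L" "card L \<le> 2 ^ (c * m)"
      unfolding L_def by (simp_all add: finite_lists_length_eq card_lists_length_eq card_bitstrings power_mult)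
    have tr: "transcript P y r m \<in> L" if "y \<in> X" for y
      using set_transcript_subset[OF cost, of r m y] that r
      by (auto simp: L_def R_def X_def m_def PiE_iff)
    have box: "\<exists>A. (\<forall>i<m. A i \<subseteq> carrier_vec n) \<and> {y \<in> X. transcript P y r m = t} = PiE {..<m} A"
      if t: "t \<in> L" for t
    proof -
      have "length t = m" using t by (simp add: L_def)
      then show ?thesis
        unfolding X_def
        by (intro exI[of _ "\<lambda>i. {a \<in> carrier_vec n. message P i a (take i t) r = t ! i}"]
            conjI allI impI transcript_fibre_box) auto
    qed
    show ?thesis
      by (rule ex_sketch_deterministic[OF m(1) L tr[unfolded X_def] box[unfolded X_def],
            of "\<lambda>t z. output_bit P z t r"])
         (auto simp: Q_def X_def \<epsilon>_def)
  qed
  then obtain G where Q: "\<And>r. r \<in> R \<Longrightarrow> Q r (G r)"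
    by metis
  have G: "linear_sketch n (10 * c) (G r)" if "r \<in> R" for r
    using Q[OF that] by (simp add: Q_def)
  have prob: "measure_pmf.prob (G r) {g. g x = b} \<ge> (\<Sum>y\<in>X. of_bool (?out r x y = b)) / card X - \<epsilon>"
    if "r \<in> R" "x \<in> carrier_vec n" for r x b
    using Q[OF that(1)] that(2) by (simp add: Q_def)
  \<comment> \<open>The shared random string becomes internal randomness of the sketch.\<close>
  have "linear_sketch n (10 * c) (pmf_of_set R \<bind> G)"
    using G R by (auto simp: linear_sketch_def)
  moreover have "sketch_computes n (pmf_of_set R \<bind> G) f (q - 2 powr (- (1 / 10) * real N))"
    unfolding sketch_computes_def
  proof
    fix x :: "bit vec" assume x: "x \<in> carrier_vec n"
    \<comment> \<open>Every \<open>y\<close> extends to an input \<open>z\<close> with sum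
      \<open>x\<close> and the same transcript, so the worst-case guarantee applies for each
      \<open>y\<close> separately.\<close>
    have success: "q \<le> (\<Sum>r\<in>R. of_bool (?out r x y = f x)) / card R" if y: "y \<in> X" for y
    proof -
      define z where "z = y(m := x + ?S y)"
      have y': "y \<in> {..<m} \<rightarrow> carrier_vec n" using y by (auto simp: X_def PiE_iff)
      have z: "\<forall>i<N. z i \<in> carrier_vec n"
        using y' x finsum_vec_closed[OF y'] by (auto simp: z_def m(2) less_Suc_eq)
      have "F z = f x"
        using F z finsum_vec_complete[OF y[unfolded X_def] x] by (simp add: z_def m(2))
      moreover have "protocol_output N P z r = ?out r x y" for r
        using transcript_cong[of m z y P r] by (simp add: protocol_output_def m(2) z_def)
      moreover have "q \<le> measure_pmf.prob (pmf_of_set R) {r. protocol_output N P z r = F z}"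
        using comp z by (simp add: protocol_computes_def R_def)
      ultimately show ?thesis
        using R by (simp add: measure_pmf_of_set Int_def)
    qed
    have "q - 2 powr (- (1 / 10) * real N) \<le> q - \<epsilon>"
      using error_bound[OF n c N] by (simp add: \<epsilon>_def m_def)
    also have "q \<le> (\<Sum>y\<in>X. (\<Sum>r\<in>R. of_bool (?out r x y = f x)) / card R) / card X"
    proof -
      have "card X * q \<le> (\<Sum>y\<in>X. (\<Sum>r\<in>R. of_bool (?out r x y = f x)) / card R)"
        using sum_mono[of X "\<lambda>_. q", OF success] by simp
      then show ?thesis
        using X by (simp add: pos_le_divide_eq card_gt_0_iff mult.commute)
    qed
    \<comment> \<open>Swapping the averages over \<open>y\<close> and \<open>r\<close> exposes, for
      each fixed \<open>r\<close>, the quantity compared with \<open>G r\<close> in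
      \<open>prob\<close>.\<close>
    also have "(\<Sum>y\<in>X. (\<Sum>r\<in>R. of_bool (?out r x y = f x)) / card R) / card X
        = (\<Sum>r\<in>R. (\<Sum>y\<in>X. of_bool (?out r x y = f x)) / card X) / card R"
      unfolding sum_divide_distrib[symmetric]
      by (subst sum.swap) (simp add: mult.commute)
    also have "\<dots> - \<epsilon> = (\<Sum>r\<in>R. (\<Sum>y\<in>X. of_bool (?out r x y = f x)) / card X - \<epsilon>) / card R"
      using R by (simp add: sum_subtractf diff_divide_distrib)
    also have "\<dots> \<le> (\<Sum>r\<in>R. measure_pmf.prob (G r) {g. g x = f x}) / card R"
      by (intro divide_right_mono sum_mono prob x) auto
    also have "\<dots> = measure_pmf.prob (pmf_of_set R \<bind> G) {g. g x = f x}"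
      by (rule prob_bind_pmf_of_set[symmetric, OF R])
    finally show "q - 2 powr (- (1 / 10) * real N)
        \<le> measure_pmf.prob (pmf_of_set R \<bind> G) {g. g x = f x}"
      by simp
  qed
  ultimately show "\<exists>k G. real k \<le> 10 * real c \<and> linear_sketch n k G \<and>
      sketch_computes n G f (q - 2 powr (- (1 / 10) * real N))"
    by (intro exI[of _ "10 * c"] exI[of _ "pmf_of_set R \<bind> G"]) simp
qed auto

end
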